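(* Let $\mathbb{V}$ be an $n$-dimensional vector space with basis $e_1,\dots,e_n$, and let $O_1,\dots,O_n$ be linear operators on $\mathbb{V}$ such that the vectors $e'_i := O_i e_i$ ($i=1,\dots,n$) form another basis of $\mathbb{V}$. Let $P_1,\dots,P_n$ be the projection operators associated with the basis $(e_i)$ and $P'_1,\dots,P'_n$ the projection operators associated with the basis $(e'_i)$. Then $\sum_{j=1}^n O_jP_j$ is invertible and, for every $i$, $$P'_i = O_i P_i \Big(\sum_{j=1}^n O_j P_j\Big)^{-1}.$$
   Context: For a basis $(b_1,\dots,b_n)$ of a vector space, the associated projection operators $\Pi_1,\dots,\Pi_n$ are the linear operators determined by $\Pi_i b_j = \delta_{ij} b_i$; equivalently, if $v=\sum_i v_i b_i$ then $\Pi_i v = v_i b_i$. The operators $O_i$ ("separated basis transformations") are linear operators on the whole space; only the value of $O_i$ on the single basis vector $e_i$ is prescribed, by $O_ie_i=e'_i$. *)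

theory Defs
  imports Complex_Main
begin

definition basis_family ::
    "('a::field \<Rightarrow> 'b::ab_group_add \<Rightarrow> 'b) \<Rightarrow> nat \<Rightarrow> (nat \<Rightarrow> 'b) \<Rightarrow> bool" where
  "basis_family scale n b \<longleftrightarrow>
     inj_on b {1..n} \<and> \<not> module.dependent scale (b ` {1..n})
       \<and> module.span scale (b ` {1..n}) = UNIV"

definition basis_projections ::
    "('a::field \<Rightarrow> 'b::ab_group_add \<Rightarrow> 'b) \<Rightarrow> nat \<Rightarrow> (nat \<Rightarrow> 'b) \<Rightarrow> (nat \<Rightarrow> 'b \<Rightarrow> 'b) \<Rightarrow> bool" where
  "basis_projections scale n b P \<longleftrightarrow>
     (\<forall>i\<in>{1..n}. Vector_Spaces.linear scale scale (P i) \<and>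
        (\<forall>j\<in>{1..n}. P i (b j) = (if i = j then b i else 0)))"

definition invertible_operator ::
    "('a::field \<Rightarrow> 'b::ab_group_add \<Rightarrow> 'b) \<Rightarrow> ('b \<Rightarrow> 'b) \<Rightarrow> bool" where
  "invertible_operator scale S \<longleftrightarrow>
     Vector_Spaces.linear scale scale S \<and>
     (\<exists>T. Vector_Spaces.linear scale scale T \<and> T \<circ> S = id \<and> S \<circ> T = id)"

text \<open>By the two lemmas below, a basis has exactly one family of projections up to irrelevant
  indices outside \<open>{1..n}\<close>. A hypothesis \<open>basis_projections scale n b P\<close> therefore merely names
  the projections associated with \<open>b\<close>.\<close>

lemma basis_projections_exist:
  assumes "vector_space scale" and b: "basis_family scale n b"
  shows "\<exists>P. basis_projections scale n b P"
proof -
  interpret vector_space scale by fact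
  interpret vs: vector_space_pair scale scale by unfold_locales
  have "\<exists>f. Vector_Spaces.linear scale scale f \<and>
          (\<forall>j\<in>{1..n}. f (b j) = (if i = j then b i else 0))"
    if i: "i \<in> {1..n}" for i
  proof -
    let ?g = "\<lambda>x. if x = b i then b i else 0"
    obtain f where f: "Vector_Spaces.linear scale scale f" "\<forall>x\<in>b ` {1..n}. f x = ?g x"
      using vs.linear_independent_extend[of "b ` {1..n}" ?g] b
      unfolding basis_family_def by blast
    have "f (b j) = (if i = j then b i else 0)" if "j \<in> {1..n}" for j
      using f(2) that i b inj_onD[of b "{1..n}" j i] unfolding basis_family_def by auto
    with f(1) show ?thesis by blast
  qed
  then show ?thesis unfolding basis_projections_def by metis
qed

lemma basis_projections_unique:
  assumes "vector_space scale" and b: "basis_family scale n b"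
    and P: "basis_projections scale n b P" and Q: "basis_projections scale n b Q"
    and i: "i \<in> {1..n}"
  shows "P i = Q i"
proof -
  interpret vector_space scale by fact
  interpret vs: vector_space_pair scale scale by unfold_locales
  have "P i x = Q i x" for x
  proof (rule vs.linear_eq_on[where f = "P i" and g = "Q i" and B = "b ` {1..n}"])
    show "Vector_Spaces.linear scale scale (P i)" "Vector_Spaces.linear scale scale (Q i)"
      using P Q i unfolding basis_projections_def by auto
    show "x \<in> span (b ` {1..n})"
      using b unfolding basis_family_def by simp
    show "P i y = Q i y" if "y \<in> b ` {1..n}" for y
      using that P Q i unfolding basis_projections_def by auto
  qed
  then show ?thesis by blast
qed

end

(* The sum S of the O_j P_j sends e_j to e'_j, hence maps a basis to a basis and is invertible.
   The operators P'_i S and O_i P_i agree on every e_j, hence are equal. *)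
theory Submission
  imports Defs
begin

text \<open>A linear map is determined by its values on a basis, and these can be prescribed freely
  (\<open>linear_eq_on_basis_family\<close>, \<open>linear_extension_basis_family\<close>). Let S be
  the sum of the O_j P_j. Since P_k kills e_j for k \<noteq> j, only one summand survives at e_j, so
  S e_j = O_j e_j = e'_j. Thus S carries a basis to a basis and is invertible
  (\<open>invertible_operator_if_basis_to_basis\<close>). Both P'_i S and O_i P_i send e_i to e'_i
  and every other e_j to 0, so they coincide; composing with the inverse of S on the right gives the
  formula.\<close>

lemma linear_eq_on_basis_family:
  assumes "vector_space scale" and b: "basis_family scale n b"
    and f: "Vector_Spaces.linear scale scale f" and g: "Vector_Spaces.linear scale scale g"
    and eq: "\<And>j. j \<in> {1..n} \<Longrightarrow> f (b j) = g (b j)"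
  shows "f = g"
proof
  fix x
  interpret vector_space scale by fact
  interpret vs: vector_space_pair scale scale by unfold_locales
  show "f x = g x"
  proof (rule vs.linear_eq_on[OF f g, where B = "b ` {1..n}"])
    show "x \<in> span (b ` {1..n})"
      using b unfolding basis_family_def by simp
  qed (use eq in auto)
qed

lemma linear_extension_basis_family:
  assumes "vector_space scale" and b: "basis_family scale n b"
  obtains f where "Vector_Spaces.linear scale scale f" "\<And>j. j \<in> {1..n} \<Longrightarrow> f (b j) = c j"
proof -
  interpret vector_space scale by fact
  interpret vs: vector_space_pair scale scale by unfold_locales
  \<comment> \<open>The library extends functions of vectors, while \<open>c\<close> depends on the
    index; injectivity of \<open>b\<close> lets \<open>the_inv_into\<close> recover the index from
    the basis vector.\<close>
  obtain f where "Vector_Spaces.linear scale scale f"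
    and f: "\<forall>x\<in>b ` {1..n}. f x = c (the_inv_into {1..n} b x)"
    using vs.linear_independent_extend[of "b ` {1..n}" "\<lambda>x. c (the_inv_into {1..n} b x)"] b
    unfolding basis_family_def by blast
  moreover have "f (b j) = c j" if "j \<in> {1..n}" for j
    using f that b unfolding basis_family_def by (simp add: the_inv_into_f_f)
  ultimately show ?thesis by (intro that)
qed

text \<open>The inverse is the linear extension T of c_j \<mapsto> b_j: T S fixes every b_j and S T
  fixes every c_j, so both are the identity.\<close>

lemma invertible_operator_if_basis_to_basis:
  assumes "vector_space scale" and b: "basis_family scale n b" and c: "basis_family scale n c"
    and S: "Vector_Spaces.linear scale scale S"
    and Sb: "\<And>j. j \<in> {1..n} \<Longrightarrow> S (b j) = c j"
  shows "invertible_operator scale S"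
proof -
  interpret vector_space scale by fact
  obtain T where T: "Vector_Spaces.linear scale scale T"
    and Tc: "\<And>j. j \<in> {1..n} \<Longrightarrow> T (c j) = b j"
    using linear_extension_basis_family[OF assms(1) c] by blast
  have "T \<circ> S = id"
    using Sb Tc by (intro linear_eq_on_basis_family[OF assms(1) b]
        Vector_Spaces.linear_compose[OF S T] linear_id) auto
  moreover have "S \<circ> T = id"
    using Sb Tc by (intro linear_eq_on_basis_family[OF assms(1) c]
        Vector_Spaces.linear_compose[OF T S] linear_id) auto
  ultimately show ?thesis
    unfolding invertible_operator_def using S T by blast
qed

theorem theorem2p1:
  fixes scale :: "'a::field \<Rightarrow> 'b::ab_group_add \<Rightarrow> 'b"
    and n :: nat
    and e :: "nat \<Rightarrow> 'b"
    and Op P P' :: "nat \<Rightarrow> 'b \<Rightarrow> 'b"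
  assumes "vector_space scale"
    and "basis_family scale n e"
    and "\<forall>i\<in>{1..n}. Vector_Spaces.linear scale scale (Op i)"
    and "basis_family scale n (\<lambda>i. Op i (e i))"
    and "basis_projections scale n e P"
    and "basis_projections scale n (\<lambda>i. Op i (e i)) P'"
  shows "let S = (\<lambda>v. \<Sum>j=1..n. Op j (P j v)) in
           invertible_operator scale S \<and>
           (\<forall>i\<in>{1..n}. P' i = Op i \<circ> P i \<circ> inv S)"
proof -
  define S where "S = (\<lambda>v. \<Sum>j=1..n. Op j (P j v))"
  interpret vector_space scale by fact
  interpret vs: vector_space_pair scale scale by unfold_locales
  have lin: "Vector_Spaces.linear scale scale (\<lambda>v. Op j (P j v))" if "j \<in> {1..n}" for j
    using Vector_Spaces.linear_compose[of scale scale "P j" scale "Op j"] assms(3,5) that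
    unfolding basis_projections_def comp_def by blast
  \<comment> \<open>For i \<noteq> j the projection gives 0, and linearity of \<open>Op i\<close>
    keeps it 0.\<close>
  have OpP: "Op i (P i (e j)) = (if i = j then Op j (e j) else 0)"
    if "i \<in> {1..n}" "j \<in> {1..n}" for i j
    using that assms(5) vs.linear_0[OF assms(3)[rule_format, of i]]
    unfolding basis_projections_def by simp
  have S: "Vector_Spaces.linear scale scale S"
    unfolding S_def using lin by (intro vs.linear_compose_sum) auto
  have Se: "S (e j) = Op j (e j)" if "j \<in> {1..n}" for j
    using that unfolding S_def by (simp add: OpP)
  have inv: "invertible_operator scale S"
    using assms(1,2,4) S Se by (rule invertible_operator_if_basis_to_basis)
  \<comment> \<open>\<open>inv\<close> is the inverse by choice; surjectivity makes it a right
    inverse, S \<circ> inv S = id, which is what the final cancellation uses.\<close>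
  then have "surj S"
    unfolding invertible_operator_def by (metis comp_apply id_apply surj_def)
  have "P' i = Op i \<circ> P i \<circ> inv S" if i: "i \<in> {1..n}" for i
  proof -
    \<comment> \<open>This is the claimed formula multiplied by S on the right, in which form it can
      be checked on the vectors e_j.\<close>
    have "P' i \<circ> S = Op i \<circ> P i"
    proof (rule linear_eq_on_basis_family[OF assms(1,2)])
      show "Vector_Spaces.linear scale scale (P' i \<circ> S)"
        using Vector_Spaces.linear_compose[OF S] assms(6) i unfolding basis_projections_def by blast
      show "Vector_Spaces.linear scale scale (Op i \<circ> P i)"
        using lin[OF i] by (simp add: comp_def)
      show "(P' i \<circ> S) (e j) = (Op i \<circ> P i) (e j)" if "j \<in> {1..n}" for j
        using that i assms(6) by (simp add: Se OpP basis_projections_def)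
    qed
    then have "Op i \<circ> P i \<circ> inv S = P' i \<circ> (S \<circ> inv S)"
      by (simp flip: comp_assoc)
    with \<open>surj S\<close> show ?thesis by (simp add: surj_iff)
  qed
  with inv show ?thesis unfolding Let_def S_def by blast
qed

end
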